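(* Let $e,u,v,q$ be complex parameters (generic, so no denominator vanishes). Let $K_3(n):=K(q^2,q^{-n},q^{1-n},q^{2-n},e,u,v,q^3)$ and put \[ C_r:=\frac{(e,q^3u,q^3v,q^5/u,q^5/v;q^3)_r}{(q^5/e,u,v,q^2/u,q^2/v;q^3)_r\,e^r},\qquad D_r:=\frac{(e/q^2,qu,qv,q^3/u,q^3/v;q^3)_r}{(q^3/e,u/q^2,v/q^2,1/u,1/v;q^3)_r\,e^r}. \] (i) The sequences with $\alpha_0=\beta_0=1$ and, for $r\ge0$ (resp. $r\ge1$ for $\alpha_{3r-1}$), \[ \alpha_{3r}=(-1)^rq^{\frac{9r^2-7r}{2}}C_r,\quad \alpha_{3r+1}=(-1)^{r+1}q^{\frac{9r^2+5r}{2}+2}C_r+(-1)^rq^{\frac{9r^2-r}{2}-3}D_{r+1},\quad \alpha_{3r-1}=(-1)^rq^{\frac{9r^2-7r}{2}}D_r, \] \[ \beta_n=K_3(n)\frac{(q^4/e;q^3)_n}{(q^2;q)_{2n}(q^3/e;q)_n}, \] form a Bailey pair relative to $a=q$. (ii) The sequences with $\alpha_0=\beta_0=1$ and \[ \alpha_{3r}=(-1)^rq^{\frac{9r^2-r}{2}}C_r,\quad \alpha_{3r+1}=(-1)^{r+1}q^{\frac{9r^2-r}{2}}C_r+(-1)^rq^{\frac{9r^2+5r}{2}-2}D_{r+1},\quad \alpha_{3r-1}=(-1)^rq^{\frac{9r^2-13r}{2}}D_r, \] \[ \beta_n=K_3(n)\frac{(q^4/e;q^3)_n\,q^n}{(q^2;q)_{2n}(q^3/e;q)_n},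 \] form a Bailey pair relative to $a=q$. (iii) The sequences with $\alpha_0=\beta_0=1$ and \[ \alpha_{3r}=(-1)^r\frac{1-q^{6r+2}}{1-q^2}q^{\frac{9r^2-7r}{2}}C_r,\quad \alpha_{3r+1}=(-1)^r\frac{1-q^{6r+4}}{1-q^2}q^{\frac{9r^2-r}{2}-3}D_{r+1},\quad \alpha_{3r-1}=0, \] \[ \beta_n=K_3(n)\frac{(q^4/e;q^3)_n}{(q^2;q)_{2n}(q^3/e;q)_n}, \] form a Bailey pair relative to $a=q^2$.
   Context: Notation: $(x;q)_n=\prod_{k=0}^{n-1}(1-xq^k)$ and $(x_1,\dots,x_k;q)_n=(x_1;q)_n\cdots(x_k;q)_n$. A pair of sequences $(\alpha_n)_{n\ge0},(\beta_n)_{n\ge0}$ is a Bailey pair relative to $a$ if $\alpha_0=1$ and $\beta_n=\sum_{j=0}^{n}\frac{\alpha_j}{(q;q)_{n-j}(aq;q)_{n+j}}$ for all $n\ge0$. The function $K$: for complex $a,b,c,d,e,u,v$ and a base $p$, let $\sigma_1,\dots,\sigma_4$ be the elementary symmetric functions of $b,c,d,e$ and \[ K(a,b,c,d,e,u,v,p):=\frac{uv(\sigma_3-a\sigma_1)(p\sigma_3-a\sigma_1)a^2+(1-p)uv(a^2-\sigma_4)(a^2-\sigma_2a+\sigma_4)a+(u+v)(a+uv)(\sigma_3-a\sigma_1)(a^2-p\sigma_4)a+(u^2+a)(v^2+a)(a^2-\sigma_4)(a^2-p\sigma_4)}{(a^2-bcde)(a^2-bcde\,p)(1-u)(a-u)(1-v)(a-v)}.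 \] *)

theory Defs
  imports Complex_Main
begin

definition qpoch :: "complex \<Rightarrow> complex \<Rightarrow> nat \<Rightarrow> complex" where
  "qpoch x q n = (\<Prod>k<n. 1 - x * q ^ k)"

definition qpochs :: "complex list \<Rightarrow> complex \<Rightarrow> nat \<Rightarrow> complex" where
  "qpochs xs q n = (\<Prod>x\<leftarrow>xs. qpoch x q n)"

definition bailey_pair ::
  "complex \<Rightarrow> complex \<Rightarrow> (nat \<Rightarrow> complex) \<Rightarrow> (nat \<Rightarrow> complex) \<Rightarrow> bool" where
  "bailey_pair q a \<alpha> \<beta> \<longleftrightarrow>
     \<alpha> 0 = 1 \<and>
     (\<forall>n. \<beta> n = (\<Sum>j\<le>n. \<alpha> j / (qpoch q q (n - j) * qpoch (a * q) q (n + j))))"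

definition K_num ::
  "complex \<Rightarrow> complex \<Rightarrow> complex \<Rightarrow> complex \<Rightarrow> complex \<Rightarrow> complex \<Rightarrow> complex \<Rightarrow> complex \<Rightarrow> complex"
where
  "K_num a b c d e u v p =
    (let \<sigma>1 = b + c + d + e;
         \<sigma>2 = b*c + b*d + b*e + c*d + c*e + d*e;
         \<sigma>3 = b*c*d + b*c*e + b*d*e + c*d*e;
         \<sigma>4 = b*c*d*e
     in u * v * (\<sigma>3 - a * \<sigma>1) * (p * \<sigma>3 - a * \<sigma>1) * a^2
        + (1 - p) * u * v * (a^2 - \<sigma>4) * (a^2 - \<sigma>2 * a + \<sigma>4) * a
        + (u + v) * (a + u * v) * (\<sigma>3 - a * \<sigma>1) * (a^2 - p * \<sigma>4) * a
        + (u^2 + a) * (v^2 + a) * (a^2 - \<sigma>4) * (a^2 - p * \<sigma>4))"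

definition K_den ::
  "complex \<Rightarrow> complex \<Rightarrow> complex \<Rightarrow> complex \<Rightarrow> complex \<Rightarrow> complex \<Rightarrow> complex \<Rightarrow> complex \<Rightarrow> complex"
where
  "K_den a b c d e u v p =
     (a^2 - b*c*d*e) * (a^2 - b*c*d*e*p) * (1 - u) * (a - u) * (1 - v) * (a - v)"

definition K ::
  "complex \<Rightarrow> complex \<Rightarrow> complex \<Rightarrow> complex \<Rightarrow> complex \<Rightarrow> complex \<Rightarrow> complex \<Rightarrow> complex \<Rightarrow> complex"
where
  "K a b c d e u v p = K_num a b c d e u v p / K_den a b c d e u v p"

definition K3 :: "complex \<Rightarrow> complex \<Rightarrow> complex \<Rightarrow> complex \<Rightarrow> nat \<Rightarrow> complex" where
  "K3 e u v q n =
     K (q^2) (q powi (- int n)) (q powi (1 - int n)) (q powi (2 - int n)) e u v (q^3)"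

definition C_den :: "complex \<Rightarrow> complex \<Rightarrow> complex \<Rightarrow> complex \<Rightarrow> nat \<Rightarrow> complex" where
  "C_den e u v q r = qpochs [q^5/e, u, v, q^2/u, q^2/v] (q^3) r * e^r"

definition C :: "complex \<Rightarrow> complex \<Rightarrow> complex \<Rightarrow> complex \<Rightarrow> nat \<Rightarrow> complex" where
  "C e u v q r = qpochs [e, q^3*u, q^3*v, q^5/u, q^5/v] (q^3) r / C_den e u v q r"

definition D_den :: "complex \<Rightarrow> complex \<Rightarrow> complex \<Rightarrow> complex \<Rightarrow> nat \<Rightarrow> complex" where
  "D_den e u v q r = qpochs [q^3/e, u/q^2, v/q^2, 1/u, 1/v] (q^3) r * e^r"

definition D :: "complex \<Rightarrow> complex \<Rightarrow> complex \<Rightarrow> complex \<Rightarrow> nat \<Rightarrow> complex" where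
  "D e u v q r = qpochs [e/q^2, q*u, q*v, q^3/u, q^3/v] (q^3) r / D_den e u v q r"

(* No denominator vanishes. The condition on (q;q)_n says that q^k \<noteq> 1 for every k \<ge> 1, which
   also gives (q^2;q)_n \<noteq> 0, (a q;q)_n \<noteq> 0 for a = q and a = q^2, and 1 - q^2 \<noteq> 0. *)
definition generic :: "complex \<Rightarrow> complex \<Rightarrow> complex \<Rightarrow> complex \<Rightarrow> bool" where
  "generic e u v q \<longleftrightarrow>
     e \<noteq> 0 \<and> u \<noteq> 0 \<and> v \<noteq> 0 \<and> q \<noteq> 0 \<and>
     (\<forall>n. qpoch q q n \<noteq> 0) \<and>
     (\<forall>r. C_den e u v q r \<noteq> 0) \<and>
     (\<forall>r. D_den e u v q r \<noteq> 0) \<and>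
     (\<forall>n. qpoch (q^3/e) q n \<noteq> 0) \<and>
     (\<forall>n. K_den (q^2) (q powi (- int n)) (q powi (1 - int n)) (q powi (2 - int n)) e u v (q^3) \<noteq> 0)"

end

theory Submission
  imports Defs
begin

text \<open>
  Put \<open>a = q\<^sup>2\<close>, \<open>p = q\<^sup>3\<close>, \<open>X = p\<^sup>r\<close> and \<open>y = 1/X + aX\<close>. The \<open>D\<close>-terms are the \<open>C\<close>-terms continued to
  negative \<open>r\<close>, so the sum in (iii) is one terminating bilateral very-well-poised sum
  over \<open>r \<in> \<int>\<close>; the sums in (i) and (ii) agree with it, after adding the
  two terms that carry the same \<open>C\<^sub>r\<close> or \<open>D\<^sub>r\<close>, up to the factor \<open>q\<^sup>n\<close> in (ii).
  Since \<open>(1 - uX)(u - aX) = X (u y - (u\<^sup>2 + a))\<close>, the parameters \<open>u\<close> and \<open>v\<close> enter only through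
  the moments of order 0, 1, 2 of \<open>y\<close>. Two telescoping identities express the moments of order
  1 and 2 by the one of order 0, which produces the numerator of \<open>K\<close>. The moment of order 0
  is found by induction on \<open>n\<close>: passing from \<open>n + 1\<close> to \<open>n\<close> multiplies
  the summand by a factor linear in \<open>y\<close>, so that the first telescoping identity yields a first-order recurrence.
\<close>

section \<open>Sums over symmetric integer intervals and over blocks of three\<close>

lemma sum_int_telescope:
  fixes G :: "int \<Rightarrow> 'a::ab_group_add"
  shows "(\<Sum>r\<in>{- int R..<int R}. G (r + 1) - G r) = G (int R) - G (- int R)"
proof (induction R)
  case (Suc R)
  have "{- int (Suc R)..<int (Suc R)} = insert (- 1 - int R) (insert (int R) {- int R..<int R})"
    by auto
  then show ?case by (simp add: Suc.IH algebra_simps)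
qed simp

text \<open>Opposite indices are \<open>r\<close> and \<open>-(r + 1)\<close> rather than
  \<open>r\<close> and \<open>-r\<close>. This matches \<alpha> at \<open>3r + 1\<close>, where
  \<open>C\<close> at \<open>r\<close> meets \<open>D\<close> at \<open>r + 1\<close>.\<close>

lemma sum_int_symmetric_split:
  fixes f :: "int \<Rightarrow> 'a::comm_monoid_add"
  shows "(\<Sum>r\<in>{- int R..<int R}. f r) = (\<Sum>r<R. f (int r) + f (- int (Suc r)))"
proof (induction R)
  case (Suc R)
  have "{- int (Suc R)..<int (Suc R)} = insert (- 1 - int R) (insert (int R) {- int R..<int R})"
    by auto
  then show ?case by (simp add: Suc.IH algebra_simps)
qed simp

lemma sum_lessThan_triple:
  fixes h :: "nat \<Rightarrow> 'a::comm_monoid_add"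
  shows "(\<Sum>j<3 * R. h j) = (\<Sum>r<R. h (3 * r) + h (3 * r + 1) + h (3 * r + 2))"
  by (induction R) (simp_all add: numeral_3_eq_3 add_ac)

text \<open>Padding by vanishing terms up to \<open>3 * Suc n\<close> completes the blocks of three.
  The number of blocks is then that of the bilateral sum with \<open>R = Suc n\<close>.\<close>

lemma sum_atMost_triple:
  fixes h :: "nat \<Rightarrow> 'a::comm_monoid_add"
  assumes "\<And>j. j > n \<Longrightarrow> h j = 0"
  shows "(\<Sum>j\<le>n. h j) = (\<Sum>r<Suc n. h (3 * r) + h (3 * r + 1) + h (3 * r + 2))"
proof -
  have "(\<Sum>j\<le>n. h j) = (\<Sum>j<3 * Suc n. h j)"
    using assms by (intro sum.mono_neutral_left) auto
  then show ?thesis by (simp only: sum_lessThan_triple)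
qed

section \<open>Moments of a terminating very-well-poised sum\<close>

text \<open>
  The recurrence is that of the bilateral \<open>\<^sub>6\<psi>\<^sub>6\<close> summand with its factor \<open>1 - aX\<^sup>2\<close> removed;
  clearing denominators keeps it valid where the summand vanishes.
\<close>

locale well_poised =
  fixes V :: "int \<Rightarrow> complex" and a b c d e p :: complex and R :: nat
  assumes p_nz: "p \<noteq> 0"
    and V_rec: "\<And>r. V (r + 1) * ((b - a*p*p powi r) * (c - a*p*p powi r) * (d - a*p*p powi r) * (e - a*p*p powi r))
          = p * a^2 * V r * ((1 - b*p powi r) * (1 - c*p powi r) * (1 - d*p powi r) * (1 - e*p powi r))"
    and V_top: "V (int R) = 0" and V_bot: "V (- int R) = 0"
begin

definition y :: "int \<Rightarrow> complex" where "y r = 1 / p powi r + a * p powi r"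

definition M :: "nat \<Rightarrow> complex" where
  "M k = (\<Sum>r\<in>{- int R..<int R}. V r * (1 - a * (p powi r)^2) * y r ^ k)"

definition "s1 = b + c + d + e"
definition "s2 = b*c + b*d + b*e + c*d + c*e + d*e"
definition "s3 = b*c*d + b*c*e + b*d*e + c*d*e"
definition "s4 = b*c*d*e"

lemma X_nz: "p powi r \<noteq> 0"
  using p_nz by simp

lemma X_Suc: "p powi (r + 1) = p * p powi r"
  using p_nz by (simp add: power_int_add)

text \<open>By \<open>V_rec\<close>, the difference of \<open>G\<close> is \<open>V r / X\<close>
  times the quartic \<open>a^2 (1-bX)(1-cX)(1-dX)(1-eX) - (b-aX)(c-aX)(d-aX)(e-aX)\<close>. Divided
  by \<open>X^2\<close>, this quartic changes sign under \<open>X -> 1/(aX)\<close>, so it equals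
  \<open>X (1 - aX^2)\<close> times a polynomial of degree 1 in \<open>y\<close>.\<close>

lemma moment1: "(a^2 - s4) * M 1 + a * (s3 - a * s1) * M 0 = 0"
proof -
  define G where "G r = V r * ((b - a*p powi r) * (c - a*p powi r) * (d - a*p powi r) * (e - a*p powi r)) / p powi r" for r
  have summand: "(a^2 - s4) * (V r * (1 - a * (p powi r)^2) * y r) + a * (s3 - a * s1) * (V r * (1 - a * (p powi r)^2))
      = G (r + 1) - G r" for r
  proof -
    define X where "X = p powi r"
    have X: "X \<noteq> 0" using X_nz X_def by simp
    have "G (r + 1) = V (r + 1) * ((b - a*p*X) * (c - a*p*X) * (d - a*p*X) * (e - a*p*X)) / (p * X)"
      by (simp add: G_def X_Suc X_def mult.assoc)
    also have "\<dots> = a^2 * V r * ((1 - b*X) * (1 - c*X) * (1 - d*X) * (1 - e*X)) / X"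
      unfolding X_def V_rec using p_nz X_nz by simp
    finally have G1: "G (r + 1) * X = a^2 * V r * ((1 - b*X) * (1 - c*X) * (1 - d*X) * (1 - e*X))"
      using X by simp
    have G0: "G r * X = V r * ((b - a*X) * (c - a*X) * (d - a*X) * (e - a*X))"
      using X by (simp add: G_def X_def)
    have yX: "y r * X = 1 + a * X^2"
      using X by (simp add: y_def X_def field_simps power2_eq_square)
    have "((a^2 - s4) * (V r * (1 - a * X^2) * y r) + a * (s3 - a * s1) * (V r * (1 - a * X^2))) * X
        = V r * ((a^2 - s4) * (1 - a * X^2) * (y r * X) + a * (s3 - a * s1) * (1 - a * X^2) * X)"
      by (simp add: algebra_simps)
    also have "\<dots> = (G (r + 1) - G r) * X"
      unfolding yX left_diff_distrib[of "G (r+1)"] G1 G0 s1_def s3_def s4_def by algebra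
    finally show ?thesis using X unfolding X_def[symmetric] by simp
  qed
  have "(a^2 - s4) * M 1 + a * (s3 - a * s1) * M 0 = (\<Sum>r\<in>{- int R..<int R}. G (r + 1) - G r)"
    unfolding M_def by (simp add: summand[symmetric] sum.distrib sum_distrib_left)
  also have "\<dots> = 0"
    unfolding sum_int_telescope by (simp add: G_def V_top V_bot)
  finally show ?thesis .
qed

text \<open>The same telescoping, one degree higher in \<open>y\<close>. The leading coefficient
  multiplies \<open>M 2 - a * M 0\<close> because \<open>y^2 - a\<close> is the quotient of
  \<open>1/X^3 - a^3 X^3\<close> by \<open>1/X - aX\<close>.\<close>

lemma moment2:
  "(a^2 - p * s4) * (M 2 - a * M 0) + a * (p * s3 - a * s1) * M 1
     + (a^2 * s2 * (1 - p) + a^3 * p - a * s4) * M 0 = 0"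
proof -
  \<comment> \<open>The weight \<open>a + p/X\<^sup>2\<close> is the one for which the difference is antisymmetric under \<open>X \<mapsto> 1/(aX)\<close>, hence divisible by \<open>1 - aX\<^sup>2\<close>.\<close>
  define G where "G r = V r * ((b - a*p powi r) * (c - a*p powi r) * (d - a*p powi r) * (e - a*p powi r))
     * (a + p / (p powi r)^2)" for r
  have summand: "(a^2 - p * s4) * (V r * (1 - a * (p powi r)^2) * (y r)^2 - a * (V r * (1 - a * (p powi r)^2)))
     + a * (p * s3 - a * s1) * (V r * (1 - a * (p powi r)^2) * y r)
     + (a^2 * s2 * (1 - p) + a^3 * p - a * s4) * (V r * (1 - a * (p powi r)^2))
      = G (r + 1) - G r" for r
  proof -
    define X where "X = p powi r"
    have X: "X \<noteq> 0" using X_nz X_def by simp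
    have "G (r + 1) = V (r + 1) * ((b - a*p*X) * (c - a*p*X) * (d - a*p*X) * (e - a*p*X)) * (a + p / (p * X)^2)"
      by (simp add: G_def X_Suc X_def mult.assoc)
    also have "\<dots> = p * a^2 * V r * ((1 - b*X) * (1 - c*X) * (1 - d*X) * (1 - e*X)) * (a + p / (p * X)^2)"
      unfolding X_def V_rec ..
    finally have "G (r + 1) * X^2 = a^2 * V r * ((1 - b*X) * (1 - c*X) * (1 - d*X) * (1 - e*X))
        * (p * (a + p / (p * X)^2) * X^2)"
      by (simp add: mult_ac)
    also have "p * (a + p / (p * X)^2) * X^2 = a * p * X^2 + 1"
      using X p_nz by (simp add: field_simps power2_eq_square)
    finally have G1: "G (r + 1) * X^2 = a^2 * V r * ((1 - b*X) * (1 - c*X) * (1 - d*X) * (1 - e*X)) * (a * p * X^2 + 1)" .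
    have G0: "G r * X^2 = V r * ((b - a*X) * (c - a*X) * (d - a*X) * (e - a*X)) * (a * X^2 + p)"
      using X by (simp add: G_def X_def field_simps)
    have yX: "y r * X = 1 + a * X^2"
      using X by (simp add: y_def X_def field_simps power2_eq_square)
    have "((a^2 - p * s4) * (V r * (1 - a * X^2) * (y r)^2 - a * (V r * (1 - a * X^2)))
     + a * (p * s3 - a * s1) * (V r * (1 - a * X^2) * y r)
     + (a^2 * s2 * (1 - p) + a^3 * p - a * s4) * (V r * (1 - a * X^2))) * X^2
        = V r * (1 - a * X^2) * ((a^2 - p * s4) * ((y r * X)^2 - a * X^2)
            + a * (p * s3 - a * s1) * (y r * X) * X
            + (a^2 * s2 * (1 - p) + a^3 * p - a * s4) * X^2)"
      by algebra
    also have "\<dots> = (G (r + 1) - G r) * X^2"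
      unfolding yX left_diff_distrib[of "G (r+1)"] G1 G0 s1_def s2_def s3_def s4_def by algebra
    finally show ?thesis using X unfolding X_def[symmetric] by simp
  qed
  have "(a^2 - p * s4) * (M 2 - a * M 0) + a * (p * s3 - a * s1) * M 1
     + (a^2 * s2 * (1 - p) + a^3 * p - a * s4) * M 0 = (\<Sum>r\<in>{- int R..<int R}. G (r + 1) - G r)"
    unfolding M_def sum_distrib_left sum_subtractf[symmetric] sum.distrib[symmetric]
    by (simp only: summand[symmetric] power_0 power_one_right mult_1_right)
  also have "\<dots> = 0"
    unfolding sum_int_telescope by (simp add: G_def V_top V_bot)
  finally show ?thesis .
qed

lemma sum_eq_K:
  assumes den: "K_den a b c d e u v p \<noteq> 0"
  shows "(\<Sum>r\<in>{- int R..<int R}. V r * (1 - a * (p powi r)^2)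
            * ((u * y r - (u^2 + a)) * (v * y r - (v^2 + a))))
         = (1 - u) * (a - u) * (1 - v) * (a - v) * K a b c d e u v p * M 0"
proof -
  define S where "S = (\<Sum>r\<in>{- int R..<int R}. V r * (1 - a * (p powi r)^2)
            * ((u * y r - (u^2 + a)) * (v * y r - (v^2 + a))))"
  define T where "T = (1 - u) * (a - u) * (1 - v) * (a - v)"
  \<comment> \<open>\<open>P\<close> is the product of the leading coefficients in
    \<open>moment1\<close> and \<open>moment2\<close>. Multiplying by it eliminates
    \<open>M 1\<close> and \<open>M 2\<close> without any division.\<close>
  define P where "P = (a^2 - s4) * (a^2 - p * s4)"
  have S: "S = u * v * M 2 - (u + v) * (a + u * v) * M 1 + (u^2 + a) * (v^2 + a) * M 0"
    unfolding S_def M_def sum_distrib_left sum_subtractf[symmetric] sum.distrib[symmetric]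
    by (rule sum.cong) (simp_all add: algebra_simps power2_eq_square)
  have "P * S = K_num a b c d e u v p * M 0"
  proof -
    have N: "K_num a b c d e u v p = u * v * (s3 - a * s1) * (p * s3 - a * s1) * a^2
        + (1 - p) * u * v * (a^2 - s4) * (a^2 - s2 * a + s4) * a
        + (u + v) * (a + u * v) * (s3 - a * s1) * (a^2 - p * s4) * a
        + (u^2 + a) * (v^2 + a) * (a^2 - s4) * (a^2 - p * s4)"
      by (simp add: K_num_def Let_def s1_def s2_def s3_def s4_def)
    show ?thesis
      using moment1 moment2 unfolding N S P_def by algebra
  qed
  moreover have den_eq: "K_den a b c d e u v p = P * T"
    by (simp add: K_den_def P_def T_def s4_def mult_ac)
  ultimately have "S = T * K a b c d e u v p * M 0"
    using den unfolding K_def den_eq by (simp add: field_simps)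
  then show ?thesis
    unfolding S_def T_def .
qed

end

section \<open>Shifted factorials and their reciprocals\<close>

lemma qpoch_Suc: "qpoch x p (Suc n) = qpoch x p n * (1 - x * p ^ n)"
  by (simp add: qpoch_def)

lemma qpoch_0 [simp]: "qpoch x p 0 = 1"
  by (simp add: qpoch_def)

lemma qpoch_shift: "qpoch (p * x) p n * (1 - x) = qpoch x p n * (1 - x * p ^ n)"
proof (induction n)
  case (Suc n)
  have "qpoch (p * x) p (Suc n) * (1 - x) = (qpoch (p * x) p n * (1 - x)) * (1 - p * x * p ^ n)"
    by (simp add: qpoch_Suc)
  also have "\<dots> = qpoch x p (Suc n) * (1 - x * p ^ Suc n)"
    unfolding Suc.IH by (simp add: qpoch_Suc mult_ac)
  finally show ?case .
qed simp

text \<open>Each quotient involving \<open>u\<close> or \<open>v\<close> in \<open>C\<close> and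
  \<open>D\<close> collapses in this way to a ratio of two linear factors, one of them independent
  of \<open>n\<close>.\<close>

lemma qpoch_quotient:
  assumes "\<And>n. qpoch x p n \<noteq> 0"
  shows "qpoch (p * x) p n / qpoch x p n = (1 - x * p ^ n) / (1 - x)"
proof -
  have "1 - x \<noteq> 0"
    using assms[of 1] by (simp add: qpoch_def)
  then show ?thesis
    using assms[of n] qpoch_shift[of p x n] by (simp add: field_simps)
qed

lemma powi_3_mult_int: "x powi (3 * int k) = (x::complex) ^ (3 * k)"
  using power_int_of_nat[of x "3 * k"] by simp

text \<open>The reciprocal \<open>1/(q;q)\<^sub>m\<close>, which is naturally \<open>0\<close> at negative \<open>m\<close>; this makes bilateral sums terminate.\<close>

definition rqfact :: "complex \<Rightarrow> int \<Rightarrow> complex" where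
  "rqfact q m = (if m < 0 then 0 else 1 / qpoch q q (nat m))"

lemma rqfact_neg: "m < 0 \<Longrightarrow> rqfact q m = 0"
  by (simp add: rqfact_def)

lemma rqfact_of_nat: "rqfact q (int n) = 1 / qpoch q q n"
  by (simp add: rqfact_def)

text \<open>At \<open>m = 0\<close> the factor \<open>1 - q powi m\<close> vanishes, just as the
  left side does. The recurrence therefore crosses the edge of the support, and later shifts require
  no case distinction.\<close>

lemma rqfact_pred:
  assumes "\<And>n. qpoch q q n \<noteq> 0"
  shows "rqfact q (m - 1) = (1 - q powi m) * rqfact q m"
proof -
  consider "m < 0" | "m = 0" | n where "m = int (Suc n)"
    by (metis gr0_implies_Suc linorder_neqE zero_less_imp_eq_int)
  then show ?thesis
  proof cases
    case (3 n)
    have "rqfact q (int (Suc n) - 1) = 1 / qpoch q q n"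
      using rqfact_of_nat[of q n] by simp
    moreover have "q powi int (Suc n) = q * q ^ n"
      by (simp only: power_int_of_nat power_Suc)
    ultimately show ?thesis
      unfolding 3 rqfact_of_nat using assms[of n] assms[of "Suc n"]
      by (simp add: qpoch_Suc)
  qed (simp_all add: rqfact_def)
qed

section \<open>The bilateral coefficient and its recurrence\<close>

text \<open>
  For \<open>r < 0\<close> this is the continuation of the first branch by
  \<open>(x;p)\<^bsub>-s\<^esub> = 1/(x p\<^bsup>-s\<^esup>;p)\<^sub>s\<close>, rewritten so that the denominators are those of \<open>D\<close>.
\<close>

definition wp_coeff :: "complex \<Rightarrow> complex \<Rightarrow> int \<Rightarrow> complex" where
  "wp_coeff e q r =
     (if 0 \<le> r
      then (-1) ^ nat r * q powi ((9 * r^2 - 7 * r) div 2)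
           * (qpoch e (q^3) (nat r) / (qpoch (q^5/e) (q^3) (nat r) * e ^ nat r))
      else (-1) ^ nat (- r) * q powi ((9 * r^2 - 17 * r) div 2)
           * (qpoch (e/q^2) (q^3) (nat (- r)) / (qpoch (q^3/e) (q^3) (nat (- r)) * e ^ nat (- r))))"

lemma wp_coeff_nonneg:
  "wp_coeff e q (int r) = (-1) ^ r * q powi ((9 * (int r)^2 - 7 * int r) div 2)
           * (qpoch e (q^3) r / (qpoch (q^5/e) (q^3) r * e ^ r))"
  by (simp add: wp_coeff_def)

lemma wp_coeff_neg:
  "wp_coeff e q (- int r) = (-1) ^ r * q powi ((9 * (int r)^2 + 17 * int r) div 2)
           * (qpoch (e/q^2) (q^3) r / (qpoch (q^3/e) (q^3) r * e ^ r))"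
  by (cases "r = 0") (simp_all add: wp_coeff_def)

text \<open>One recurrence serves both branches. The seam from \<open>-1\<close> to \<open>0\<close>
  falls under the second case, since \<open>wp_coeff_neg\<close> also holds at
  \<open>0\<close>.\<close>

lemma wp_coeff_rec:
  assumes q: "q \<noteq> 0" and e: "e \<noteq> 0"
    and den1: "\<And>r. qpoch (q^5/e) (q^3) r \<noteq> 0" and den2: "\<And>r. qpoch (q^3/e) (q^3) r \<noteq> 0"
  shows "wp_coeff e q (r + 1) * (e - q^5 * q powi (3 * r))
       = - q * (q powi (3 * r))^3 * (1 - e * q powi (3 * r)) * wp_coeff e q r"
proof (cases "0 \<le> r")
  case True
  then obtain k where r: "r = int k"
    using nonneg_int_cases by blast
  define X where "X = q ^ (3 * k)"
  have X: "q powi (3 * r) = X"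
    unfolding X_def r by (rule powi_3_mult_int)
  have p: "(q^3) ^ k = X"
    by (simp add: X_def power_mult)
  \<comment> \<open>The halved exponent grows by \<open>9r + 1\<close>. Writing \<open>9r\<close> as
    three copies of \<open>3r\<close> turns the new power into \<open>X^3 * q\<close>.\<close>
  have "9 * (r + 1)^2 - 7 * (r + 1) = (9 * r^2 - 7 * r) + 2 * (3 * r + 3 * r + 3 * r + 1)"
    by (simp add: power2_eq_square algebra_simps)
  then have ex: "(9 * (r + 1)^2 - 7 * (r + 1)) div 2 = (9 * r^2 - 7 * r) div 2 + (3 * r + 3 * r + 3 * r + 1)"
    by simp
  have pw: "q powi ((9 * (r + 1)^2 - 7 * (r + 1)) div 2) = q powi ((9 * r^2 - 7 * r) div 2) * (X^3 * q)"
    unfolding ex power_int_add[OF disjI1[OF q]] X by (simp add: power3_eq_cube)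
  have nz: "e - q^5 * X \<noteq> 0"
    using den1[of "Suc k"] e by (simp add: qpoch_Suc p field_simps)
  have "wp_coeff e q (r + 1) = wp_coeff e q (int (Suc k))"
    by (simp add: r add.commute)
  also have "\<dots> = (-1) ^ Suc k * q powi ((9 * (r + 1)^2 - 7 * (r + 1)) div 2)
           * (qpoch e (q^3) (Suc k) / (qpoch (q^5/e) (q^3) (Suc k) * e ^ Suc k))"
    unfolding wp_coeff_nonneg r by (simp add: add.commute)
  finally have s: "wp_coeff e q (r + 1) = \<dots>" .
  show ?thesis
    unfolding s pw unfolding X unfolding r wp_coeff_nonneg qpoch_Suc p
    using nz den1[of k] e by (simp add: field_simps)
next
  case False
  then obtain k where r: "r = - int (Suc k)"
    by (metis int_cases of_nat_0_le_iff)
  define Y where "Y = q ^ (3 * k)"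
  have Y: "Y \<noteq> 0" using q by (simp add: Y_def)
  have "3 * r = - (3 + 3 * int k)" by (simp add: r)
  then have "q powi (3 * r) = inverse (q powi 3 * q ^ (3 * k))"
    by (simp only: power_int_minus power_int_add[OF disjI1[OF q]] powi_3_mult_int)
  then have X: "q powi (3 * r) = 1 / (q^3 * Y)"
    by (simp add: Y_def inverse_eq_divide)
  have p: "(q^3) ^ k = Y"
    by (simp add: Y_def power_mult)
  have "9 * (int (Suc k))^2 + 17 * int (Suc k) = (9 * (int k)^2 + 17 * int k) + 2 * (int (3 * k) + int (3 * k) + int (3 * k) + 13)"
    by (simp add: power2_eq_square algebra_simps)
  then have ex: "(9 * (int (Suc k))^2 + 17 * int (Suc k)) div 2 = (9 * (int k)^2 + 17 * int k) div 2 + (int (3 * k) + int (3 * k) + int (3 * k) + 13)"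
    by simp
  have pw: "q powi ((9 * (int (Suc k))^2 + 17 * int (Suc k)) div 2) = q powi ((9 * (int k)^2 + 17 * int k) div 2) * (Y^3 * q^13)"
    unfolding ex power_int_add[OF disjI1[OF q]] power_int_of_nat Y_def[symmetric]
    by (simp add: power3_eq_cube)
  have nz: "e - q^3 * Y \<noteq> 0"
    using den2[of "Suc k"] e by (simp add: qpoch_Suc p field_simps)
  have r1: "r + 1 = - int k" by (simp add: r)
  define Z where "Z = q powi ((9 * (int k)^2 + 17 * int k) div 2)"
  define A B where "A = qpoch (e/q^2) (q^3) k" and "B = qpoch (q^3/e) (q^3) k"
  have B: "B \<noteq> 0" using den2 by (simp add: B_def)
  have c0: "wp_coeff e q (r + 1) = (-1) ^ k * Z * (A / (B * e ^ k))"
    unfolding r1 wp_coeff_neg Z_def A_def B_def ..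
  have c1: "wp_coeff e q r = - ((-1) ^ k * (Z * (Y^3 * q^13)) * (A * (1 - e/q^2 * Y) / (B * (1 - q^3/e * Y) * (e ^ k * e))))"
    unfolding r wp_coeff_neg pw Z_def A_def B_def qpoch_Suc p by simp
  have ratio: "(1 - e/q^2 * Y) / ((1 - q^3/e * Y) * e) = (q^2 - e * Y) / (q^2 * (e - q^3 * Y))"
  proof -
    have "1 - e/q^2 * Y = (q^2 - e * Y) / q^2" "(1 - q^3/e * Y) * e = e - q^3 * Y"
      using e q by (simp_all add: field_simps)
    then show ?thesis by simp
  qed
  have c1': "wp_coeff e q r = - ((-1) ^ k * Z * (A / (B * e ^ k))) * (Y^3 * q^13 * ((q^2 - e * Y) / (q^2 * (e - q^3 * Y))))"
    unfolding c1 ratio[symmetric] times_divide_times_eq times_divide_eq_left times_divide_eq_right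
    by (simp add: mult_ac)
  have "e - q^5 * (1 / (q^3 * Y)) = - ((q^2 - e * Y) / Y)"
    using q Y by (simp add: field_simps power_numeral_reduce)
  moreover have "q * (1 / (q^3 * Y))^3 * (1 - e * (1 / (q^3 * Y))) * (Y^3 * q^13 * ((q^2 - e * Y) / (q^2 * (e - q^3 * Y)))) = - ((q^2 - e * Y) / Y)"
  proof -
    have "1 - e * (1 / (q^3 * Y)) = - ((e - q^3 * Y) / (q^3 * Y))"
      using q Y by (simp add: field_simps)
    then show ?thesis using q Y nz by (simp add: field_simps power_numeral_reduce)
  qed
  \<comment> \<open>Here \<open>g\<close> stands for \<open>wp_coeff e q (r + 1)\<close>, which is a
    factor of both sides. The two remaining cofactors were just shown to equal
    \<open>- ((q^2 - e * Y) / Y)\<close>.\<close>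
  moreover have "g * s = - m * x * z * (- g * w)" if "s = t" "m * x * z * w = t" for g m s t x z w :: complex
    using that(2) unfolding that(1) by (simp add: mult_ac)
  ultimately show ?thesis
    unfolding X c0 c1' by blast
qed

section \<open>Consequences of genericity\<close>

locale generic_parameters =
  fixes e u v q :: complex
  assumes generic: "generic e u v q"
begin

lemma nonzero: "e \<noteq> 0" "u \<noteq> 0" "v \<noteq> 0" "q \<noteq> 0"
  using generic by (auto simp: generic_def)

lemma qpoch_q_nonzero: "qpoch q q n \<noteq> 0"
  using generic by (auto simp: generic_def)

lemma C_den_nonzero:
  "qpoch (q^5/e) (q^3) r \<noteq> 0" "qpoch u (q^3) r \<noteq> 0" "qpoch v (q^3) r \<noteq> 0"
  "qpoch (q^2/u) (q^3) r \<noteq> 0" "qpoch (q^2/v) (q^3) r \<noteq> 0"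
  using generic by (auto simp: generic_def C_den_def qpochs_def)

lemma D_den_nonzero:
  "qpoch (q^3/e) (q^3) r \<noteq> 0" "qpoch (u/q^2) (q^3) r \<noteq> 0" "qpoch (v/q^2) (q^3) r \<noteq> 0"
  "qpoch (1/u) (q^3) r \<noteq> 0" "qpoch (1/v) (q^3) r \<noteq> 0"
  using generic by (auto simp: generic_def D_den_def qpochs_def)

lemma K_den_nonzero:
  "K_den (q^2) (q powi (- int n)) (q powi (1 - int n)) (q powi (2 - int n)) e u v (q^3) \<noteq> 0"
  using generic by (auto simp: generic_def)

lemma one_minus_power_nonzero: "1 - q * q ^ n \<noteq> 0"
  using qpoch_q_nonzero[of "Suc n"] by (simp add: qpoch_Suc)

lemma qpoch_q2: "qpoch (q^2) q n = qpoch q q (Suc n) / (1 - q)"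
  using qpoch_shift[of q q n] one_minus_power_nonzero[of 0]
  by (simp add: qpoch_Suc field_simps power2_eq_square)

lemma qpoch_q3: "qpoch (q^3) q n = qpoch q q (Suc (Suc n)) / ((1 - q) * (1 - q^2))"
proof -
  have nz: "1 - q^2 \<noteq> 0"
    using one_minus_power_nonzero[of 1] by (simp add: power2_eq_square)
  have "qpoch (q^3) q n * (1 - q^2) = qpoch q q (Suc (Suc n)) / (1 - q)"
    unfolding qpoch_q2[symmetric] unfolding qpoch_Suc
    using qpoch_shift[of q "q^2" n] by (simp add: power3_eq_cube power2_eq_square mult.assoc)
  then show ?thesis
    using nz by (simp add: nonzero_eq_divide_eq[OF nz] flip: divide_divide_eq_left)
qed

section \<open>The summand in base \<open>q^3\<close> and its moment of order 0\<close>

lemma cube_powi: "(q^3) powi r = q powi (3 * r)"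
  by (simp add: power_int_mult)

text \<open>The square is the factor \<open>X^2\<close> that comes out when the factors of
  \<open>u\<close> and \<open>v\<close> are written in terms of \<open>y\<close>. The parameters
  \<open>q powi (-n)\<close>, \<open>q powi (1-n)\<close>, \<open>q powi (2-n)\<close> are hidden in
  the reciprocal factorials, whose arguments move by three when \<open>r\<close> moves by one. The
  factor \<open>1 - q\<close> makes the moment of order 0 equal to 1 at
  \<open>n = 0\<close>.\<close>

definition V :: "nat \<Rightarrow> int \<Rightarrow> complex" where
  "V n r = wp_coeff e q r * (q powi (3 * r))^2
     * ((1 - q) * rqfact q (int n - 3 * r) * rqfact q (int n + 3 * r + 2))"

lemma V_well_poised:
  assumes R: "n + 2 < 3 * R"
  shows "well_poised (V n) (q^2) (q powi (- int n)) (q powi (1 - int n)) (q powi (2 - int n)) e (q^3) R"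
proof
  show "q^3 \<noteq> 0" using nonzero by simp
  \<comment> \<open>At \<open>r = R\<close> the argument \<open>n - 3R\<close> is negative. At
    \<open>r = -R\<close> it is \<open>n - 3R + 2\<close>, which explains the \<open>2\<close> in
    the bound on \<open>R\<close>.\<close>
  show "V n (int R) = 0" "V n (- int R) = 0"
    using R by (simp_all add: V_def rqfact_neg)
  fix r
  define X Q where "X = q powi (3 * r)" and "Q = q ^ n"
  have nz: "X \<noteq> 0" "Q \<noteq> 0" "q \<noteq> 0" using nonzero by (auto simp: X_def Q_def)
  have pw: "q powi (- int n) = 1 / Q" "q powi (1 - int n) = q / Q" "q powi (2 - int n) = q^2 / Q"
    using nz unfolding Q_def by (simp_all add: power_int_diff power_int_minus field_simps)
  have X1: "q powi (3 * (r + 1)) = q^3 * X"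
    using nz unfolding X_def by (simp add: power_int_add distrib_left)
  have "q powi (int n - 3 * r) = Q / X" "q powi (int n - 3 * r - 1) = Q / (q * X)"
      "q powi (int n - 3 * r - 1 - 1) = Q / (q^2 * X)"
    using nz unfolding X_def Q_def by (simp_all add: power_int_diff power2_eq_square mult_ac)
  then have "rqfact q (int n - 3 * r - 1 - 1 - 1)
      = (1 - Q / (q^2 * X)) * ((1 - Q / (q * X)) * ((1 - Q / X) * rqfact q (int n - 3 * r)))"
    by (simp only: rqfact_pred[OF qpoch_q_nonzero])
  then have E: "rqfact q (int n - 3 * (r + 1)) = (1 - Q / X) * (1 - Q / (q * X)) * (1 - Q / (q^2 * X)) * rqfact q (int n - 3 * r)"
    by (simp only: mult_ac) (simp add: algebra_simps)
  have F: "rqfact q (int n + 3 * r + 2) = (1 - q^3 * Q * X) * (1 - q^4 * Q * X) * (1 - q^5 * Q * X) * rqfact q (int n + 3 * (r + 1) + 2)"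
  proof -
    define m where "m = int n + 3 * r + 5"
    have "q powi m = q^5 * Q * X" "q powi (m - 1) = q^4 * Q * X" "q powi (m - 1 - 1) = q^3 * Q * X"
      using nz unfolding X_def Q_def m_def by (simp_all add: power_int_diff power_int_add power_numeral_reduce)
    then have "rqfact q (m - 1 - 1 - 1) = (1 - q^3 * Q * X) * ((1 - q^4 * Q * X) * ((1 - q^5 * Q * X) * rqfact q m))"
      by (simp only: rqfact_pred[OF qpoch_q_nonzero])
    moreover have "m - 1 - 1 - 1 = int n + 3 * r + 2" "m = int n + 3 * (r + 1) + 2"
      by (simp_all add: m_def)
    ultimately show ?thesis by (simp only: mult.assoc)
  qed
  have c: "wp_coeff e q (r + 1) * (e - q^5 * X) = - q * X^3 * (1 - e * X) * wp_coeff e q r"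
    unfolding X_def using wp_coeff_rec nonzero C_den_nonzero D_den_nonzero by blast
  define E1 F1 c0 c1 where "E1 = rqfact q (int n - 3 * r)" and "F1 = rqfact q (int n + 3 * (r + 1) + 2)"
    and "c0 = wp_coeff e q r" and "c1 = wp_coeff e q (r + 1)"
  \<comment> \<open>The three factors released by the second reciprocal factorial are, up to powers
    of \<open>q\<close> and \<open>Q\<close>, the factors \<open>b - a p X\<close>. Those released
    by the first one are, up to a monomial, the factors \<open>1 - b X\<close>.\<close>
  have b: "1 / Q - q^2 * q^3 * X = (1 - q^5 * Q * X) / Q" "q / Q - q^2 * q^3 * X = q * (1 - q^4 * Q * X) / Q"
     "q^2 / Q - q^2 * q^3 * X = q^2 * (1 - q^3 * Q * X) / Q"
    using nz by (simp_all add: field_simps power_numeral_reduce)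
  have g: "(1 - Q / X) * (1 - Q / (q * X)) * (1 - Q / (q^2 * X)) = - ((Q / (q * X))^3) * ((1 - 1 / Q * X) * (1 - q / Q * X) * (1 - q^2 / Q * X))"
    using nz by (simp add: field_simps power_numeral_reduce)
  define g1 where "g1 = (1 - 1 / Q * X) * (1 - q / Q * X) * (1 - q^2 / Q * X)"
  define f1 where "f1 = (1 - q^3 * Q * X) * (1 - q^4 * Q * X) * (1 - q^5 * Q * X)"
  have "V n (r + 1) * ((1 / Q - q^2 * q^3 * X) * (q / Q - q^2 * q^3 * X) * (q^2 / Q - q^2 * q^3 * X) * (e - q^2 * q^3 * X))
      = (c1 * (e - q^5 * X)) * (q^3 * X)^2 * ((1 - q) * (- ((Q / (q * X))^3) * g1 * E1) * F1) * (f1 * q^3 / Q^3)"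
    unfolding V_def X1 E g b c1_def E1_def F1_def f1_def g1_def
    by (simp add: power3_eq_cube power2_eq_square power_numeral_reduce mult_ac)
  also have "\<dots> = q^3 * (q^2)^2 * (c0 * X^2 * ((1 - q) * E1 * (f1 * F1))) * (g1 * (1 - e * X))"
    unfolding c[folded c0_def c1_def] using nz by (simp add: field_simps power_numeral_reduce)
  also have "\<dots> = q^3 * (q^2)^2 * V n r * ((1 - 1 / Q * X) * (1 - q / Q * X) * (1 - q^2 / Q * X) * (1 - e * X))"
    unfolding V_def F c0_def E1_def F1_def f1_def g1_def X_def[symmetric] by simp
  finally show "V n (r + 1) *
         ((q powi (- int n) - q^2 * q^3 * (q^3) powi r) * (q powi (1 - int n) - q^2 * q^3 * (q^3) powi r) *
          (q powi (2 - int n) - q^2 * q^3 * (q^3) powi r) * (e - q^2 * q^3 * (q^3) powi r)) =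
         q^3 * (q^2)^2 * V n r *
         ((1 - q powi (- int n) * (q^3) powi r) * (1 - q powi (1 - int n) * (q^3) powi r) *
          (1 - q powi (2 - int n) * (q^3) powi r) * (1 - e * (q^3) powi r))"
    unfolding cube_powi pw X_def[symmetric] .
qed

text \<open>With \<open>X = q powi (3 * r)\<close>, the two reciprocal factorials release
  \<open>1 - q^(n+1)/X\<close> and \<open>1 - q^(n+3) X\<close>. The map
  \<open>X -> 1/(q^2 X)\<close> exchanges these factors, so their product is linear in
  \<open>y\<close>.\<close>

lemma V_pred:
  "V n r = V (Suc n) r * (1 + q^4 * (q^n)^2 - q * q^n * (1 / q powi (3 * r) + q^2 * q powi (3 * r)))"
proof -
  define X Q where "X = q powi (3 * r)" and "Q = q ^ n"
  have nz: "X \<noteq> 0" "Q \<noteq> 0" "q \<noteq> 0" using nonzero by (auto simp: X_def Q_def)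
  have E: "rqfact q (int n - 3 * r) = (1 - q * Q / X) * rqfact q (int (Suc n) - 3 * r)"
    using rqfact_pred[OF qpoch_q_nonzero, of "int (Suc n) - 3 * r"] nz
    unfolding X_def Q_def by (simp add: power_int_add power_int_diff algebra_simps)
  have F: "rqfact q (int n + 3 * r + 2) = (1 - q^3 * Q * X) * rqfact q (int (Suc n) + 3 * r + 2)"
    using rqfact_pred[OF qpoch_q_nonzero, of "int n + 3 * r + 3"] nz
    unfolding X_def Q_def by (simp add: power_int_add algebra_simps)
  have "(1 - q * Q / X) * (1 - q^3 * Q * X) = 1 + q^4 * Q^2 - q * Q * (1 / X + q^2 * X)"
    using nz by (simp add: field_simps power_numeral_reduce)
  then show ?thesis
    unfolding V_def E F X_def[symmetric] Q_def[symmetric] by (simp add: mult_ac)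
qed

definition P :: "nat \<Rightarrow> complex" where
  "P n = qpoch (q^4/e) (q^3) n / (qpoch (q^2) q (2 * n) * qpoch (q^3/e) q n)"

lemma base_sum:
  assumes "n + 2 < 3 * R"
  shows "(\<Sum>r\<in>{- int R..<int R}. V n r * (1 - q^2 * (q powi (3 * r))^2)) = P n"
  using assms
proof (induction n)
  case 0
  \<comment> \<open>The arguments \<open>-3r\<close> and \<open>3r + 2\<close> are both nonnegative
    only for \<open>r = 0\<close>.\<close>
  have "V 0 r = 0" if "r \<noteq> 0" for r
    using that by (cases "r < 0") (simp_all add: V_def rqfact_neg)
  then have "(\<Sum>r\<in>{- int R..<int R}. V 0 r * (1 - q^2 * (q powi (3 * r))^2))
      = (\<Sum>r\<in>{0}. V 0 r * (1 - q^2 * (q powi (3 * r))^2))"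
    using 0 by (intro sum.mono_neutral_right) auto
  also have "\<dots> = 1"
    using one_minus_power_nonzero[of 0] one_minus_power_nonzero[of 1]
    by (simp add: V_def rqfact_def wp_coeff_def qpoch_def numeral_2_eq_2 power2_eq_square)
  finally show ?case by (simp add: P_def)
next
  case (Suc n)
  \<comment> \<open>The moments are taken at \<open>Suc n\<close>, where \<open>V_pred\<close>
    expresses the sum at \<open>n\<close> through \<open>W.M 0\<close> and \<open>W.M 1\<close>. The
    bound for \<open>Suc n\<close> implies that for \<open>n\<close>, so \<open>R\<close> stays
    fixed.\<close>
  interpret W: well_poised "V (Suc n)" "q^2" "q powi (- int (Suc n))" "q powi (1 - int (Suc n))"
    "q powi (2 - int (Suc n))" e "q^3" R
    by (rule V_well_poised) (use Suc.prems in simp)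
  define Q where "Q = q ^ n"
  have nz: "Q \<noteq> 0" "q \<noteq> 0" "e \<noteq> 0" using nonzero by (auto simp: Q_def)
  have y: "1 / q powi (3 * r) + q^2 * q powi (3 * r) = W.y r" for r
    by (simp add: W.y_def cube_powi)
  have M0: "W.M 0 = (\<Sum>r\<in>{- int R..<int R}. V (Suc n) r * (1 - q^2 * (q powi (3 * r))^2))"
    by (simp add: W.M_def cube_powi)
  have "(\<Sum>r\<in>{- int R..<int R}. V n r * (1 - q^2 * (q powi (3 * r))^2))
      = (1 + q^4 * Q^2) * W.M 0 - q * Q * W.M 1"
    unfolding W.M_def sum_distrib_left sum_subtractf[symmetric] V_pred[of n] Q_def cube_powi y
    by (rule sum.cong) (simp_all add: algebra_simps)
  moreover have "(\<Sum>r\<in>{- int R..<int R}. V n r * (1 - q^2 * (q powi (3 * r))^2)) = P n"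
    using Suc by simp
  ultimately have rec: "P n = (1 + q^4 * Q^2) * W.M 0 - q * Q * W.M 1"
    by simp
  have pw: "q powi (- int (Suc n)) = 1 / (q * Q)" "q powi (1 - int (Suc n)) = 1 / Q" "q powi (2 - int (Suc n)) = q / Q"
    using nz unfolding Q_def by (simp_all add: power_int_diff power_int_minus power_int_add field_simps)
  have s4: "Q^3 * ((q^2)^2 - W.s4) = q^4 * Q^3 - e"
    unfolding W.s4_def unfolding pw using nz by (simp add: field_simps power_numeral_reduce)
  have s31: "q^3 * Q^4 * (W.s3 - q^2 * W.s1)
      = q^3 * Q + e * (q^2 + q^3 + q^4) * Q^2 - (q^4 + q^5 + q^6) * Q^3 - q^5 * e * Q^4"
    unfolding W.s3_def W.s1_def unfolding pw using nz by (simp add: field_simps power_numeral_reduce)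
  \<comment> \<open>The multiplier is \<open>Q^3\<close> times the leading coefficient of
    \<open>moment1\<close>, so \<open>W.M 1\<close> can be replaced. It ends up as the new numerator
    factor of \<open>P (Suc n)\<close>, up to \<open>-e\<close>.\<close>
  have "(q^4 * Q^3 - e) * P n
     = (q^4 * Q^3 - e) * (1 + q^4 * Q^2) * W.M 0 - q * Q * (Q^3 * ((q^2)^2 - W.s4) * W.M 1)"
    unfolding rec s4 by (simp add: algebra_simps)
  also have "Q^3 * ((q^2)^2 - W.s4) * W.M 1 = - (Q^3 * (q^2 * (W.s3 - q^2 * W.s1)) * W.M 0)"
    using W.moment1 by algebra
  also have "(q^4 * Q^3 - e) * (1 + q^4 * Q^2) * W.M 0 - q * Q * - (Q^3 * (q^2 * (W.s3 - q^2 * W.s1)) * W.M 0)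
     = ((q^4 * Q^3 - e) * (1 + q^4 * Q^2) + q^3 * Q^4 * (W.s3 - q^2 * W.s1)) * W.M 0"
    by (simp add: algebra_simps power_numeral_reduce)
  \<comment> \<open>The coefficient of \<open>W.M 0\<close> factors completely; its factors are the
    new denominators of \<open>P (Suc n)\<close>, again up to \<open>-e\<close>.\<close>
  also have "\<dots> = (q^3 * Q - e) * (1 - q^2 * Q^2) * (1 - q^3 * Q^2) * W.M 0"
    unfolding s31 by algebra
  finally have eq: "(q^4 * Q^3 - e) * P n = (q^3 * Q - e) * (1 - q^2 * Q^2) * (1 - q^3 * Q^2) * W.M 0" .
  have n1: "1 - q^2 * Q^2 \<noteq> 0" "1 - q^3 * Q^2 \<noteq> 0"
    using one_minus_power_nonzero[of "Suc (2 * n)"] one_minus_power_nonzero[of "Suc (Suc (2 * n))"]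
    by (simp_all add: Q_def power_mult power2_eq_square power3_eq_cube power_mult_distrib mult_ac flip: power_add)
  have n2: "1 - q^3 / e * Q \<noteq> 0"
    using generic unfolding generic_def Q_def by (metis qpoch_Suc mult_zero_right)
  have PS: "P (Suc n) = P n * (1 - q^4 / e * Q^3) / ((1 - q^2 * Q^2) * (1 - q^3 * Q^2) * (1 - q^3 / e * Q))"
  proof -
    have Q2: "q ^ (2 * n) = Q^2"
      by (simp add: Q_def mult.commute flip: power_mult)
    have dbl: "qpoch (q^2) q (2 * Suc n) = qpoch (q^2) q (2 * n) * ((1 - q^2 * Q^2) * (1 - q^3 * Q^2))"
      by (simp add: qpoch_Suc Q2 power_numeral_reduce mult.assoc)
    have cube: "(q^3) ^ n = Q^3"
      by (simp add: Q_def flip: power_mult) (simp add: mult.commute)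
    show ?thesis
      unfolding P_def dbl qpoch_Suc cube Q_def[symmetric] by simp
  qed
  have "W.M 0 = P (Suc n)"
  proof -
    have "(q^3 * Q - e) = - e * (1 - q^3 / e * Q)" "(q^4 * Q^3 - e) = - e * (1 - q^4 / e * Q^3)"
      using nz by (simp_all add: field_simps)
    then have "(1 - q^4 / e * Q^3) * P n = (1 - q^3 / e * Q) * (1 - q^2 * Q^2) * (1 - q^3 * Q^2) * W.M 0"
      using eq nz(3) by (simp add: mult.assoc)
    moreover have "(1 - q^2 * Q^2) * (1 - q^3 * Q^2) * (1 - q^3 / e * Q) \<noteq> 0"
      using n1 n2 by (simp only: mult_eq_0_iff) simp
    ultimately show ?thesis
      unfolding PS by (intro nonzero_eq_divide_eq[THEN iffD2]) (simp_all only: mult_ac not_False_eq_True)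
  qed
  then show ?case by (simp add: M0)
qed

section \<open>The factors of \<open>u\<close> and \<open>v\<close>, and the identification with
  \<open>C\<close> and \<open>D\<close>\<close>

definition w :: "complex \<Rightarrow> int \<Rightarrow> complex" where
  "w x r = (1 - x * q powi (3 * r)) * (x - q^2 * q powi (3 * r)) / ((1 - x) * (x - q^2))"

definition A :: "int \<Rightarrow> complex" where
  "A r = wp_coeff e q r * w u r * w v r"

lemma one_minus_uv_nonzero: "1 - u \<noteq> 0" "u - q^2 \<noteq> 0" "1 - v \<noteq> 0" "v - q^2 \<noteq> 0"
  using K_den_nonzero[of 0] by (auto simp: K_den_def)

lemma A_0: "A 0 = 1"
  using one_minus_uv_nonzero by (simp add: A_def w_def wp_coeff_def)

lemma w_nonneg:
  assumes "x \<noteq> 0" "\<And>r. qpoch x (q^3) r \<noteq> 0" "\<And>r. qpoch (q^2/x) (q^3) r \<noteq> 0"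
  shows "w x (int r) = (qpoch (q^3*x) (q^3) r / qpoch x (q^3) r)
           * (qpoch (q^5/x) (q^3) r / qpoch (q^2/x) (q^3) r)"
proof -
  define X where "X = q ^ (3 * r)"
  have X: "q powi (3 * int r) = X" "(q^3) ^ r = X"
    unfolding X_def by (simp_all only: power_mult powi_3_mult_int)
  have "q^3 * (q^2/x) = q^5/x"
    by (simp flip: power_add)
  then have "qpoch (q^5/x) (q^3) r / qpoch (q^2/x) (q^3) r = (1 - q^2/x * X) / (1 - q^2/x)"
    using qpoch_quotient[OF assms(3), of r] by (simp only: X)
  also have "\<dots> = (x - q^2 * X) / (x - q^2)"
    using assms(1) by (simp add: divide_simps)
  finally show ?thesis
    unfolding qpoch_quotient[OF assms(2)] w_def X by simp
qed

lemma w_neg: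
  assumes "x \<noteq> 0" "\<And>r. qpoch (x/q^2) (q^3) r \<noteq> 0" "\<And>r. qpoch (1/x) (q^3) r \<noteq> 0"
  shows "w x (- int r) * (q ^ (3 * r))^2 = (qpoch (q*x) (q^3) r / qpoch (x/q^2) (q^3) r)
           * (qpoch (q^3/x) (q^3) r / qpoch (1/x) (q^3) r)"
proof -
  define Y where "Y = q ^ (3 * r)"
  have nz: "Y \<noteq> 0" "q \<noteq> 0" using nonzero by (simp_all add: Y_def)
  have X: "q powi (3 * (- int r)) = 1 / Y" "(q^3) ^ r = Y"
    unfolding Y_def mult_minus_right power_int_minus powi_3_mult_int
    by (simp_all add: power_mult inverse_eq_divide)
  have "q^3 * (x/q^2) = q * x" "q^3 * (1/x) = q^3/x"
    using nz by (simp_all add: field_simps power_numeral_reduce)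
  then have a: "qpoch (q*x) (q^3) r / qpoch (x/q^2) (q^3) r = (1 - x/q^2 * Y) / (1 - x/q^2)"
      and b: "qpoch (q^3/x) (q^3) r / qpoch (1/x) (q^3) r = (1 - 1/x * Y) / (1 - 1/x)"
    using qpoch_quotient[OF assms(2), of r] qpoch_quotient[OF assms(3), of r] by (simp_all only: X)
  have a': "(1 - x/q^2 * Y) / (1 - x/q^2) = (q^2 - x * Y) / (q^2 - x)"
    using nz by (simp add: divide_simps)
  have b': "(1 - 1/x * Y) / (1 - 1/x) = (x - Y) / (x - 1)"
    using assms(1) by (simp add: divide_simps)
  have "w x (- int r) * Y^2 = ((1 - x * (1/Y)) * Y) * ((x - q^2 * (1/Y)) * Y) / ((1 - x) * (x - q^2))"
    unfolding w_def X by (simp add: power2_eq_square)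
  also have "(1 - x * (1/Y)) * Y = - (x - Y)" using nz by (simp add: field_simps)
  also have "(x - q^2 * (1/Y)) * Y = - (q^2 - x * Y)" using nz by (simp add: field_simps)
  also have "(1 - x) * (x - q^2) = (q^2 - x) * (x - 1)" by (simp add: algebra_simps)
  finally show ?thesis
    unfolding a b a' b' Y_def[symmetric] minus_mult_minus times_divide_times_eq by (simp only: mult.commute)
qed

lemma A_nonneg: "A (int r) = (-1) ^ r * q powi ((9 * int r ^ 2 - 7 * int r) div 2) * C e u v q r"
proof -
  have C: "w u (int r) * w v (int r) * (qpoch e (q^3) r / (qpoch (q^5/e) (q^3) r * e ^ r)) = C e u v q r"
    unfolding w_nonneg[OF nonzero(2) C_den_nonzero(2,4)] w_nonneg[OF nonzero(3) C_den_nonzero(3,5)]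
    by (simp add: C_def C_den_def qpochs_def mult_ac)
  show ?thesis
    unfolding A_def wp_coeff_nonneg C[symmetric] by (simp only: mult_ac)
qed

text \<open>The exponent in \<open>wp_coeff_neg\<close> exceeds the stated one by
  \<open>12r\<close>. This surplus is \<open>Y^4\<close>, and \<open>w_neg\<close> absorbs one
  \<open>Y^2\<close> for \<open>u\<close> and one for \<open>v\<close>. Hence the \<open>D\<close>
  side carries the same prefactor as the \<open>C\<close> side.\<close>

lemma A_neg: "A (- int r) = (-1) ^ r * q powi ((9 * int r ^ 2 - 7 * int r) div 2) * D e u v q r"
proof -
  define Y where "Y = q ^ (3 * r)"
  define Z where "Z = q powi ((9 * int r ^ 2 - 7 * int r) div 2)"
  have nz: "Y \<noteq> 0" "q \<noteq> 0" using nonzero by (simp_all add: Y_def)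
  have D: "(w u (- int r) * Y^2) * (w v (- int r) * Y^2)
        * (qpoch (e/q^2) (q^3) r / (qpoch (q^3/e) (q^3) r * e ^ r)) = D e u v q r"
    unfolding Y_def w_neg[OF nonzero(2) D_den_nonzero(2,4)] w_neg[OF nonzero(3) D_den_nonzero(3,5)]
    by (simp add: D_def D_den_def qpochs_def mult_ac)
  have "9 * int r ^ 2 + 17 * int r = (9 * int r ^ 2 - 7 * int r) + 2 * (int (3 * r) + int (3 * r) + int (3 * r) + int (3 * r))"
    by simp
  then have ex: "(9 * int r ^ 2 + 17 * int r) div 2 = (9 * int r ^ 2 - 7 * int r) div 2 + (int (3 * r) + int (3 * r) + int (3 * r) + int (3 * r))"
    by simp
  have pw: "q powi ((9 * int r ^ 2 + 17 * int r) div 2) = Z * (Y^2 * Y^2)"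
    unfolding ex power_int_add[OF disjI1[OF nz(2)]] power_int_of_nat Y_def[symmetric] Z_def
    by (simp add: power2_eq_square)
  show ?thesis
    unfolding A_def wp_coeff_neg D[symmetric] pw Z_def[symmetric] by (simp only: mult_ac)
qed

section \<open>Evaluation of the bilateral sum\<close>

definition bilateral_term :: "nat \<Rightarrow> int \<Rightarrow> complex" where
  "bilateral_term n r = A r * ((1 - q^2 * (q powi (3 * r))^2)
            * ((1 - q) * rqfact q (int n - 3 * r) * rqfact q (int n + 3 * r + 2)))"

lemma sum_bilateral_term:
  assumes "n + 2 < 3 * R"
  shows "(\<Sum>r\<in>{- int R..<int R}. bilateral_term n r) = K3 e u v q n * P n"
proof -
  interpret W: well_poised "V n" "q^2" "q powi (- int n)" "q powi (1 - int n)"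
    "q powi (2 - int n)" e "q^3" R
    by (rule V_well_poised) (rule assms)
  \<comment> \<open>\<open>T\<close> clears the denominators of \<open>w u\<close> and
    \<open>w v\<close>. The signs of \<open>q^2 - u\<close> and \<open>q^2 - v\<close> are those of
    \<open>K_den\<close>; the two sign changes cancel.\<close>
  define T where "T = (1 - u) * (q^2 - u) * (1 - v) * (q^2 - v)"
  have T: "T \<noteq> 0" using one_minus_uv_nonzero by (simp add: T_def)
  have "T * bilateral_term n r
      = V n r * (1 - q^2 * ((q^3) powi r)^2) * ((u * W.y r - (u^2 + q^2)) * (v * W.y r - (v^2 + q^2)))" for r
  proof -
    define X where "X = q powi (3 * r)"
    have X: "X \<noteq> 0" using nonzero by (simp add: X_def)
    have lin: "(1 - x * X) * (x - q^2 * X) = X * (x * W.y r - (x^2 + q^2))" for x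
      unfolding W.y_def cube_powi X_def[symmetric] using X by (simp add: field_simps power2_eq_square)
    have "T * A r = wp_coeff e q r * ((1 - u * X) * (u - q^2 * X)) * ((1 - v * X) * (v - q^2 * X))"
    proof -
      have "T = ((1 - u) * (u - q^2)) * ((1 - v) * (v - q^2))"
        by (simp add: T_def algebra_simps)
      then show ?thesis
        unfolding A_def w_def X_def[symmetric] using one_minus_uv_nonzero by (simp add: mult_ac)
    qed
    then have "T * A r = wp_coeff e q r * X^2 * ((u * W.y r - (u^2 + q^2)) * (v * W.y r - (v^2 + q^2)))"
      unfolding lin by (simp add: power2_eq_square mult_ac)
    then show ?thesis
      unfolding V_def bilateral_term_def cube_powi X_def[symmetric] by (simp add: mult.assoc[symmetric])
  qed
  then have "T * (\<Sum>r\<in>{- int R..<int R}. bilateral_term n r)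
     = T * K3 e u v q n * W.M 0"
    unfolding sum_distrib_left T_def K3_def by (simp only: W.sum_eq_K[OF K_den_nonzero])
  moreover have "W.M 0 = P n"
    using base_sum[OF assms] by (simp add: W.M_def cube_powi)
  ultimately show ?thesis
    using T by simp
qed

section \<open>Bailey sums rewritten as the bilateral sum\<close>

lemma sum_bilateral_term_pairs:
  "(\<Sum>r<Suc n. bilateral_term n (int r) + bilateral_term n (- int (Suc r))) = K3 e u v q n * P n"
  unfolding sum_int_symmetric_split[symmetric] by (rule sum_bilateral_term) simp

text \<open>Serves (i) and (ii), which differ only in \<open>g\<close>, \<open>h\<close> and
  \<open>t\<close>. Each \<open>A k\<close> occurs in two terms of the Bailey sum, with weights
  \<open>g k\<close> and \<open>- h k\<close>; the identity \<open>gh\<close> merges them into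
  \<open>t n\<close> times one bilateral term.\<close>

lemma bailey_pair_q:
  assumes \<alpha>0: "\<And>r. \<alpha> (3 * r) = g (int r) * A (int r)"
    and \<alpha>1: "\<And>r. \<alpha> (3 * r + 1) = - h (int r) * A (int r) - h (- int (Suc r)) * A (- int (Suc r))"
    and \<alpha>2: "\<And>r. \<alpha> (3 * r + 2) = g (- int (Suc r)) * A (- int (Suc r))"
    and g0: "g 0 = 1"
    and gh: "\<And>n k. g k * (1 - q^2 * q^n * q powi (3 * k)) - h k * (1 - q^n / q powi (3 * k))
               = t n * (1 - q^2 * (q powi (3 * k))^2)"
    and \<beta>: "\<And>n. \<beta> n = K3 e u v q n * (t n * P n)"
  shows "\<alpha> 0 = 1 \<and> \<beta> 0 = 1 \<and> bailey_pair q q \<alpha> \<beta>"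
proof -
  have one: "\<alpha> 0 = 1"
    using \<alpha>0[of 0] g0 A_0 by simp
  have sum: "\<beta> n = (\<Sum>j\<le>n. \<alpha> j / (qpoch q q (n - j) * qpoch (q * q) q (n + j)))" for n
  proof -
    define E where "E k = rqfact q (int n + k)" for k
    define H where "H j = \<alpha> j * ((1 - q) * E (- int j) * E (int j + 1))" for j
    have F: "bilateral_term n k = A k * ((1 - q^2 * (q powi (3 * k))^2) * ((1 - q) * E (- 3 * k) * E (3 * k + 2)))" for k
      by (simp add: bilateral_term_def E_def add.assoc)
    have "\<alpha> j / (qpoch q q (n - j) * qpoch (q * q) q (n + j)) = H j" if "j \<le> n" for j
    proof -
      have "E (- int j) = 1 / qpoch q q (n - j)"
        unfolding E_def rqfact_of_nat[symmetric] using that by (simp add: of_nat_diff)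
      moreover have "E (int j + 1) = 1 / qpoch q q (Suc (n + j))"
        unfolding E_def rqfact_of_nat[symmetric] by (simp add: algebra_simps)
      moreover have "qpoch (q * q) q (n + j) = qpoch q q (Suc (n + j)) / (1 - q)"
        using qpoch_q2[of "n + j"] by (simp only: power2_eq_square)
      ultimately show ?thesis unfolding H_def by simp
    qed
    then have "(\<Sum>j\<le>n. \<alpha> j / (qpoch q q (n - j) * qpoch (q * q) q (n + j))) = (\<Sum>j\<le>n. H j)"
      by simp
    also have "\<dots> = (\<Sum>r<Suc n. H (3 * r) + H (3 * r + 1) + H (3 * r + 2))"
      by (rule sum_atMost_triple) (simp add: H_def E_def rqfact_neg)
    also have "\<dots> = (\<Sum>r<Suc n. t n * (bilateral_term n (int r) + bilateral_term n (- int (Suc r))))"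
    proof (rule sum.cong[OF refl])
      fix r
      \<comment> \<open>One application of \<open>rqfact_pred\<close> to each product brings both to
        the common factor \<open>E (- 3 * k) * E (3 * k + 2)\<close>.\<close>
      have pair: "A k * ((1 - q) * (g k * E (- 3 * k) * E (3 * k + 1) - h k * E (- 3 * k - 1) * E (3 * k + 2))) = t n * bilateral_term n k" for k
      proof -
        have a: "E (- 3 * k - 1) = (1 - q^n / q powi (3 * k)) * E (- 3 * k)"
          unfolding E_def using rqfact_pred[OF qpoch_q_nonzero, of "int n - 3 * k"] nonzero(4)
          by (simp add: power_int_diff algebra_simps)
        have b: "E (3 * k + 1) = (1 - q^2 * q^n * q powi (3 * k)) * E (3 * k + 2)"
          unfolding E_def using rqfact_pred[OF qpoch_q_nonzero, of "int n + 3 * k + 2"] nonzero(4)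
          by (simp add: power_int_add algebra_simps)
        have "g k * E (- 3 * k) * E (3 * k + 1) - h k * E (- 3 * k - 1) * E (3 * k + 2)
           = (g k * (1 - q^2 * q^n * q powi (3 * k)) - h k * (1 - q^n / q powi (3 * k))) * (E (- 3 * k) * E (3 * k + 2))"
        proof -
          have "g' * x * (b' * y) - h' * (a' * x) * y = (g' * b' - h' * a') * (x * y)" for g' h' a' b' x y :: complex
            by (simp add: algebra_simps)
          then show ?thesis unfolding a b .
        qed
        then show ?thesis
          unfolding gh F by (simp only: mult_ac)
      qed
      define k where "k = - int (Suc r)"
      have i: "- int (3 * r) = - 3 * int r" "int (3 * r) + 1 = 3 * int r + 1" "- int (3 * r + 1) = - 3 * int r - 1"
        "int (3 * r + 1) + 1 = 3 * int r + 2" by simp_all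
      \<comment> \<open>The product \<open>E (-j) * E (j + 1)\<close> is invariant under
        \<open>j -> -1 - j\<close>, which sends \<open>3r + 2\<close> and \<open>3r + 1\<close> to
        \<open>3k\<close> and \<open>3k + 1\<close>. So \<open>pair\<close> also covers the negative
        indices.\<close>
      have i': "- int (3 * r + 1) = 3 * k + 2" "int (3 * r + 1) + 1 = - 3 * k - 1" "- int (3 * r + 2) = 3 * k + 1"
        "int (3 * r + 2) + 1 = - 3 * k" by (simp_all add: k_def)
      have "H (3 * r) + H (3 * r + 1) + H (3 * r + 2)
         = g (int r) * A (int r) * ((1 - q) * E (- int (3 * r)) * E (int (3 * r) + 1))
           - h (int r) * A (int r) * ((1 - q) * E (- int (3 * r + 1)) * E (int (3 * r + 1) + 1))
           - h k * A k * ((1 - q) * E (- int (3 * r + 1)) * E (int (3 * r + 1) + 1))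
           + g k * A k * ((1 - q) * E (- int (3 * r + 2)) * E (int (3 * r + 2) + 1))"
        unfolding H_def \<alpha>0 \<alpha>1 \<alpha>2 k_def by (simp only: left_diff_distrib) simp
      also have "\<dots> = g (int r) * A (int r) * ((1 - q) * E (- 3 * int r) * E (3 * int r + 1))
           - h (int r) * A (int r) * ((1 - q) * E (- 3 * int r - 1) * E (3 * int r + 2))
           - h k * A k * ((1 - q) * E (3 * k + 2) * E (- 3 * k - 1))
           + g k * A k * ((1 - q) * E (3 * k + 1) * E (- 3 * k))"
        using i i' by metis
      also have "\<dots> = t n * bilateral_term n (int r) + t n * bilateral_term n k"
        unfolding pair[symmetric] by (simp only: algebra_simps)
      finally show "H (3 * r) + H (3 * r + 1) + H (3 * r + 2) = t n * (bilateral_term n (int r) + bilateral_term n (- int (Suc r)))"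
        by (simp only: k_def distrib_left)
    qed
    also have "\<dots> = t n * (K3 e u v q n * P n)"
      unfolding sum_distrib_left[symmetric] sum_bilateral_term_pairs ..
    finally show ?thesis unfolding \<beta> by simp
  qed
  then have "\<beta> 0 = 1" using one by simp
  with one sum show ?thesis unfolding bailey_pair_def by blast
qed

text \<open>Relative to \<open>q^2\<close> the symmetry is \<open>j -> -2 - j\<close>, which sends
  \<open>3r + 1\<close> to \<open>3k\<close> with \<open>k = -(r + 1)\<close>. Every nonzero term is
  therefore a single bilateral term, and no merging takes place.\<close>

lemma bailey_pair_q2:
  assumes \<alpha>0: "\<And>r. \<alpha> (3 * r) = (1 - q^2 * (q powi (3 * int r))^2) / (1 - q^2) * A (int r)"
    and \<alpha>1: "\<And>r. \<alpha> (3 * r + 1) = (1 - q^2 * (q powi (3 * (- int (Suc r))))^2) / (1 - q^2) * A (- int (Suc r))"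
    and \<alpha>2: "\<And>r. \<alpha> (3 * r + 2) = 0"
    and \<beta>: "\<And>n. \<beta> n = K3 e u v q n * P n"
  shows "\<alpha> 0 = 1 \<and> \<beta> 0 = 1 \<and> bailey_pair q (q^2) \<alpha> \<beta>"
proof -
  have q2: "1 - q^2 \<noteq> 0"
    using one_minus_power_nonzero[of 1] by (simp add: power2_eq_square)
  have one: "\<alpha> 0 = 1"
    using \<alpha>0[of 0] A_0 q2 by simp
  have sum: "\<beta> n = (\<Sum>j\<le>n. \<alpha> j / (qpoch q q (n - j) * qpoch (q^2 * q) q (n + j)))" for n
  proof -
    define E where "E k = rqfact q (int n + k)" for k
    define H where "H j = \<alpha> j * ((1 - q) * (1 - q^2) * E (- int j) * E (int j + 2))" for j
    have F: "bilateral_term n k = A k * ((1 - q^2 * (q powi (3 * k))^2) * ((1 - q) * E (- 3 * k) * E (3 * k + 2)))" for k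
      by (simp add: bilateral_term_def E_def add.assoc)
    have "\<alpha> j / (qpoch q q (n - j) * qpoch (q^2 * q) q (n + j)) = H j" if "j \<le> n" for j
    proof -
      have "E (- int j) = 1 / qpoch q q (n - j)"
        unfolding E_def rqfact_of_nat[symmetric] using that by (simp add: of_nat_diff)
      moreover have "E (int j + 2) = 1 / qpoch q q (Suc (Suc (n + j)))"
        unfolding E_def rqfact_of_nat[symmetric] by (simp add: algebra_simps)
      moreover have "qpoch (q^2 * q) q (n + j) = qpoch q q (Suc (Suc (n + j))) / ((1 - q) * (1 - q^2))"
        using qpoch_q3[of "n + j"] by (simp only: power2_eq_square power3_eq_cube)
      ultimately show ?thesis unfolding H_def by simp
    qed
    then have "(\<Sum>j\<le>n. \<alpha> j / (qpoch q q (n - j) * qpoch (q^2 * q) q (n + j))) = (\<Sum>j\<le>n. H j)"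
      by simp
    also have "\<dots> = (\<Sum>r<Suc n. H (3 * r) + H (3 * r + 1) + H (3 * r + 2))"
      by (rule sum_atMost_triple) (simp add: H_def E_def rqfact_neg)
    also have "\<dots> = (\<Sum>r<Suc n. bilateral_term n (int r) + bilateral_term n (- int (Suc r)))"
    proof (rule sum.cong[OF refl])
      fix r
      define k where "k = - int (Suc r)"
      have i: "- int (3 * r) = - 3 * int r" "int (3 * r) + 2 = 3 * int r + 2"
        "- int (3 * r + 1) = 3 * k + 2" "int (3 * r + 1) + 2 = - 3 * k" by (simp_all add: k_def)
      have "H (3 * r) = bilateral_term n (int r)"
        unfolding H_def \<alpha>0 F i using q2 by simp
      moreover have "H (3 * r + 1) = bilateral_term n k"
        unfolding H_def \<alpha>1 F i k_def[symmetric] using q2 by simp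
      moreover have "H (3 * r + 2) = 0"
        unfolding H_def \<alpha>2 by simp
      ultimately show "H (3 * r) + H (3 * r + 1) + H (3 * r + 2)
          = bilateral_term n (int r) + bilateral_term n (- int (Suc r))"
        by (simp add: k_def)
    qed
    also have "\<dots> = \<beta> n"
      unfolding sum_bilateral_term_pairs \<beta> ..
    finally show ?thesis by simp
  qed
  then have "\<beta> 0 = 1" using one by simp
  with one sum show ?thesis unfolding bailey_pair_def by blast
qed

section \<open>The stated powers of \<open>q\<close> expressed through \<open>A\<close>\<close>

lemma powi_half_add: "q powi ((x + 2 * y) div 2) = q powi (x div 2) * q powi y"
  using nonzero(4) by (simp add: power_int_add)

lemma neg_shift_powi: "q powi (3 * (- int (Suc r))) = 1 / (q^3 * q powi (3 * int r))"
proof -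
  have "3 * (- int (Suc r)) = - (3 + 3 * int r)"
    by simp
  then have "q powi (3 * (- int (Suc r))) = inverse (q powi 3 * q powi (3 * int r))"
    by (simp only: power_int_minus power_int_add[OF disjI1[OF nonzero(4)]])
  then show ?thesis by (simp add: inverse_eq_divide)
qed

lemma C_term_i:
  "(-1) ^ (r + 1) * q powi ((9 * int r ^ 2 + 5 * int r) div 2 + 2) * C e u v q r
     = - (q^2 * (q powi (3 * int r))^2) * A (int r)"
proof -
  \<comment> \<open>The two numerators differ by an explicit even integer, which passes through
    \<open>div 2\<close> without a parity argument.\<close>
  have "9 * int r ^ 2 + 5 * int r = (9 * int r ^ 2 - 7 * int r) + 2 * (3 * int r + 3 * int r)"
    by simp
  then have "q powi ((9 * int r ^ 2 + 5 * int r) div 2)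
      = q powi ((9 * int r ^ 2 - 7 * int r) div 2) * q powi (3 * int r + 3 * int r)"
    by (simp only: powi_half_add)
  then show ?thesis
    unfolding A_nonneg power_int_add[OF disjI1[OF nonzero(4)]] by (simp add: power2_eq_square)
qed

lemma D_term_i:
  "(-1) ^ r * q powi ((9 * int r ^ 2 - int r) div 2 - 3) * D e u v q (r + 1)
     = - (q^2 * (q powi (3 * (- int (Suc r))))^2) * A (- int (Suc r))"
proof -
  define X where "X = q powi (3 * int r)"
  have X: "X \<noteq> 0" using nonzero by (simp add: X_def)
  \<comment> \<open>The stated offset \<open>-3\<close> is the \<open>1\<close> gained here minus
    the \<open>4\<close> coming from \<open>q^2 / (q^3 * X)^2\<close>.\<close>
  have "9 * int (Suc r) ^ 2 - 7 * int (Suc r) = (9 * int r ^ 2 - int r) + 2 * (3 * int r + 3 * int r + 1)"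
    by (simp add: power2_eq_square algebra_simps)
  then have "q powi ((9 * int (Suc r) ^ 2 - 7 * int (Suc r)) div 2)
      = q powi ((9 * int r ^ 2 - int r) div 2) * q powi (3 * int r + 3 * int r + 1)"
    by (simp only: powi_half_add)
  also have "q powi (3 * int r + 3 * int r + 1) = X * X * q"
    unfolding X_def power_int_add[OF disjI1[OF nonzero(4)]] by simp
  finally show ?thesis
    unfolding A_neg neg_shift_powi X_def[symmetric] power_int_diff[OF disjI1[OF nonzero(4)]]
    using X nonzero(4) by (simp add: field_simps power_numeral_reduce)
qed

lemma C_term_ii:
  "(-1) ^ r * q powi ((9 * int r ^ 2 - int r) div 2) * C e u v q r = q powi (3 * int r) * A (int r)"
proof -
  have "9 * int r ^ 2 - int r = (9 * int r ^ 2 - 7 * int r) + 2 * (3 * int r)"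
    by simp
  then have "q powi ((9 * int r ^ 2 - int r) div 2)
      = q powi ((9 * int r ^ 2 - 7 * int r) div 2) * q powi (3 * int r)"
    by (simp only: powi_half_add)
  then show ?thesis
    unfolding A_nonneg by simp
qed

lemma D_term_ii:
  "(-1) ^ r * q powi ((9 * int r ^ 2 + 5 * int r) div 2 - 2) * D e u v q (r + 1)
     = - (q powi (3 * (- int (Suc r)))) * A (- int (Suc r))"
proof -
  define X where "X = q powi (3 * int r)"
  have X: "X \<noteq> 0" using nonzero by (simp add: X_def)
  have "9 * int (Suc r) ^ 2 - 7 * int (Suc r) = (9 * int r ^ 2 + 5 * int r) + 2 * (3 * int r + 1)"
    by (simp add: power2_eq_square algebra_simps)
  then have "q powi ((9 * int (Suc r) ^ 2 - 7 * int (Suc r)) div 2)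
      = q powi ((9 * int r ^ 2 + 5 * int r) div 2) * q powi (3 * int r + 1)"
    by (simp only: powi_half_add)
  also have "q powi (3 * int r + 1) = X * q"
    unfolding X_def power_int_add[OF disjI1[OF nonzero(4)]] by simp
  finally show ?thesis
    unfolding A_neg neg_shift_powi X_def[symmetric] power_int_diff[OF disjI1[OF nonzero(4)]]
    using X nonzero(4) by (simp add: field_simps power_numeral_reduce)
qed

lemma D_term_ii':
  "(-1) ^ r * q powi ((9 * int r ^ 2 - 13 * int r) div 2) * D e u v q r
     = q powi (3 * (- int r)) * A (- int r)"
proof -
  have "9 * int r ^ 2 - 13 * int r = (9 * int r ^ 2 - 7 * int r) + 2 * (3 * (- int r))"
    by simp
  then have "q powi ((9 * int r ^ 2 - 13 * int r) div 2)
      = q powi ((9 * int r ^ 2 - 7 * int r) div 2) * q powi (3 * (- int r))"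
    by (simp only: powi_half_add)
  then show ?thesis
    unfolding A_neg by simp
qed

text \<open>With \<open>z = q^2 * (q powi (3 * k))^2\<close> and \<open>k = -(r + 1)\<close>, the
  factor \<open>1 - q ^ (6 * r + 4)\<close> is \<open>1 - 1/z\<close>. It turns the coefficient
  \<open>-z\<close> of \<open>D_term_i\<close> into \<open>1 - z\<close>.\<close>

lemma D_term_iii:
  "(-1) ^ r * (1 - q ^ (6 * r + 4)) * q powi ((9 * int r ^ 2 - int r) div 2 - 3) * D e u v q (r + 1)
     = (1 - q^2 * (q powi (3 * (- int (Suc r))))^2) * A (- int (Suc r))"
proof -
  define X where "X = q powi (3 * int r)"
  have X: "X \<noteq> 0" using nonzero by (simp add: X_def)
  have "X = q ^ (3 * r)"
    unfolding X_def by (rule powi_3_mult_int)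
  then have pw: "q ^ (6 * r + 4) = q^4 * X^2"
    by (simp add: power_add flip: power_mult)
  have Y: "(1 - q^4 * X^2) * (q^2 * (1 / (q^3 * X))^2) = - (1 - q^2 * (1 / (q^3 * X))^2)"
    using X nonzero(4) by (simp add: field_simps power_numeral_reduce)
  have "(-1) ^ r * (1 - q ^ (6 * r + 4)) * q powi ((9 * int r ^ 2 - int r) div 2 - 3) * D e u v q (r + 1)
     = (1 - q ^ (6 * r + 4)) * ((-1) ^ r * q powi ((9 * int r ^ 2 - int r) div 2 - 3) * D e u v q (r + 1))"
    by (simp only: mult_ac)
  also have "\<dots> = - ((1 - q^4 * X^2) * (q^2 * (1 / (q^3 * X))^2)) * A (- int (Suc r))"
    unfolding D_term_i pw neg_shift_powi X_def[symmetric] by simp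
  finally show ?thesis
    unfolding Y neg_shift_powi X_def[symmetric] by simp
qed

end

section \<open>The three Bailey pairs\<close>

theorem theorem2p7:
  fixes e u v q :: complex
  assumes "generic e u v q"
  shows
    "(\<forall>\<alpha> \<beta> :: nat \<Rightarrow> complex.
        (\<forall>r. \<alpha> (3 * r) = (-1) ^ r * q powi ((9 * int r ^ 2 - 7 * int r) div 2) * C e u v q r) \<longrightarrow>
        (\<forall>r. \<alpha> (3 * r + 1) =
              (-1) ^ (r + 1) * q powi ((9 * int r ^ 2 + 5 * int r) div 2 + 2) * C e u v q r
              + (-1) ^ r * q powi ((9 * int r ^ 2 - int r) div 2 - 3) * D e u v q (r + 1)) \<longrightarrow>
        (\<forall>r\<ge>1. \<alpha> (3 * r - 1) =
              (-1) ^ r * q powi ((9 * int r ^ 2 - 7 * int r) div 2) * D e u v q r) \<longrightarrow>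
        (\<forall>n. \<beta> n =
              K3 e u v q n * (qpoch (q^4/e) (q^3) n / (qpoch (q^2) q (2 * n) * qpoch (q^3/e) q n))) \<longrightarrow>
        \<alpha> 0 = 1 \<and> \<beta> 0 = 1 \<and> bailey_pair q q \<alpha> \<beta>)
     \<and>
     (\<forall>\<alpha> \<beta> :: nat \<Rightarrow> complex.
        (\<forall>r. \<alpha> (3 * r) = (-1) ^ r * q powi ((9 * int r ^ 2 - int r) div 2) * C e u v q r) \<longrightarrow>
        (\<forall>r. \<alpha> (3 * r + 1) =
              (-1) ^ (r + 1) * q powi ((9 * int r ^ 2 - int r) div 2) * C e u v q r
              + (-1) ^ r * q powi ((9 * int r ^ 2 + 5 * int r) div 2 - 2) * D e u v q (r + 1)) \<longrightarrow>
        (\<forall>r\<ge>1. \<alpha> (3 * r - 1) =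
              (-1) ^ r * q powi ((9 * int r ^ 2 - 13 * int r) div 2) * D e u v q r) \<longrightarrow>
        (\<forall>n. \<beta> n =
              K3 e u v q n *
                (qpoch (q^4/e) (q^3) n * q ^ n / (qpoch (q^2) q (2 * n) * qpoch (q^3/e) q n))) \<longrightarrow>
        \<alpha> 0 = 1 \<and> \<beta> 0 = 1 \<and> bailey_pair q q \<alpha> \<beta>)
     \<and>
     (\<forall>\<alpha> \<beta> :: nat \<Rightarrow> complex.
        (\<forall>r. \<alpha> (3 * r) =
              (-1) ^ r * ((1 - q ^ (6 * r + 2)) / (1 - q^2))
              * q powi ((9 * int r ^ 2 - 7 * int r) div 2) * C e u v q r) \<longrightarrow>
        (\<forall>r. \<alpha> (3 * r + 1) =
              (-1) ^ r * ((1 - q ^ (6 * r + 4)) / (1 - q^2))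
              * q powi ((9 * int r ^ 2 - int r) div 2 - 3) * D e u v q (r + 1)) \<longrightarrow>
        (\<forall>r\<ge>1. \<alpha> (3 * r - 1) = 0) \<longrightarrow>
        (\<forall>n. \<beta> n =
              K3 e u v q n * (qpoch (q^4/e) (q^3) n / (qpoch (q^2) q (2 * n) * qpoch (q^3/e) q n))) \<longrightarrow>
        \<alpha> 0 = 1 \<and> \<beta> 0 = 1 \<and> bailey_pair q (q^2) \<alpha> \<beta>)"
proof -
  interpret generic_parameters e u v q
    by (rule generic_parameters.intro) (rule assms)
  have X: "q powi (3 * k) \<noteq> 0" for k
    using nonzero by simp
  show ?thesis
  \<comment> \<open>The instance of \<open>conjI\<close> splits only conjunctions that start with a
    quantifier, so each of the three conclusions stays in one piece.\<close>
  proof (intro conjI[of "All _"] allI impI, goal_cases)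
    case (1 \<alpha> \<beta>)
    show ?case
    \<comment> \<open>With \<open>a = q^2\<close>, \<open>Q = q^n\<close> and
      \<open>X = q powi (3 * k)\<close>, the required identity reads
      \<open>(1 - aQX) - aX^2 (1 - Q/X) = 1 - aX^2\<close>.\<close>
    proof (rule bailey_pair_q[where g = "\<lambda>_. 1" and h = "\<lambda>k. q^2 * (q powi (3 * k))^2" and t = "\<lambda>_. 1"])
      fix r
      show "\<alpha> (3 * r) = 1 * A (int r)"
        using 1(1) by (simp add: A_nonneg)
      show "\<alpha> (3 * r + 1) = - (q^2 * (q powi (3 * int r))^2) * A (int r)
          - q^2 * (q powi (3 * (- int (Suc r))))^2 * A (- int (Suc r))"
        unfolding 1(2)[rule_format] C_term_i D_term_i by simp
      show "\<alpha> (3 * r + 2) = 1 * A (- int (Suc r))"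
        using 1(3)[rule_format, of "Suc r"] unfolding A_neg by simp
    next
      fix n k
      show "1 * (1 - q^2 * q^n * q powi (3 * k)) - q^2 * (q powi (3 * k))^2 * (1 - q^n / q powi (3 * k))
          = 1 * (1 - q^2 * (q powi (3 * k))^2)"
        using X[of k] by (simp add: field_simps power2_eq_square)
      show "\<beta> n = K3 e u v q n * (1 * P n)"
        using 1(4) by (simp add: P_def)
    qed simp
  next
    case (2 \<alpha> \<beta>)
    show ?case
    \<comment> \<open>In the same notation, \<open>X (1 - aQX) - X (1 - Q/X) = Q (1 - aX^2)\<close>,
      which is the source of the extra \<open>q^n\<close> in \<beta>.\<close>
    proof (rule bailey_pair_q[where g = "\<lambda>k. q powi (3 * k)" and h = "\<lambda>k. q powi (3 * k)" and t = "\<lambda>n. q ^ n"])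
      fix r
      show "\<alpha> (3 * r) = q powi (3 * int r) * A (int r)"
        unfolding 2(1)[rule_format] C_term_ii ..
      have "(-1) ^ (r + 1) * q powi ((9 * int r ^ 2 - int r) div 2) * C e u v q r
          = - ((-1) ^ r * q powi ((9 * int r ^ 2 - int r) div 2) * C e u v q r)"
        by simp
      then show "\<alpha> (3 * r + 1) = - (q powi (3 * int r)) * A (int r)
          - q powi (3 * (- int (Suc r))) * A (- int (Suc r))"
        unfolding 2(2)[rule_format] C_term_ii D_term_ii by simp
      show "\<alpha> (3 * r + 2) = q powi (3 * (- int (Suc r))) * A (- int (Suc r))"
        using 2(3)[rule_format, of "Suc r"] unfolding D_term_ii' by simp
    next
      fix n k
      show "q powi (3 * k) * (1 - q^2 * q^n * q powi (3 * k)) - q powi (3 * k) * (1 - q^n / q powi (3 * k))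
          = q ^ n * (1 - q^2 * (q powi (3 * k))^2)"
        using X[of k] by (simp add: field_simps power2_eq_square)
      show "\<beta> n = K3 e u v q n * (q ^ n * P n)"
        using 2(4) by (simp add: P_def mult_ac)
    qed simp
  next
    case (3 \<alpha> \<beta>)
    show ?case
    proof (rule bailey_pair_q2)
      fix r
      have "q powi (3 * int r) = q ^ (3 * r)"
        by (rule powi_3_mult_int)
      moreover have "6 * r + 2 = 2 + (3 * r + 3 * r)"
        by simp
      ultimately have "q ^ (6 * r + 2) = q^2 * (q powi (3 * int r))^2"
        by (simp only: power_add power2_eq_square)
      then show "\<alpha> (3 * r) = (1 - q^2 * (q powi (3 * int r))^2) / (1 - q^2) * A (int r)"
        unfolding 3(1)[rule_format] A_nonneg by simp
      show "\<alpha> (3 * r + 1) = (1 - q^2 * (q powi (3 * (- int (Suc r))))^2) / (1 - q^2) * A (- int (Suc r))"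
        unfolding 3(2)[rule_format] times_divide_eq_left times_divide_eq_right D_term_iii by (rule refl)
      show "\<alpha> (3 * r + 2) = 0"
        using 3(3)[rule_format, of "Suc r"] by simp
    next
      fix n
      show "\<beta> n = K3 e u v q n * P n"
        using 3(4) by (simp add: P_def)
    qed
  qed
qed

end
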